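(* Let $1\le k<n$ be integers, let $M_0\subset\mathbb{R}^{n-k+1}$ be an orientable smooth hypersurface with $|m|<1$ for all $m\in M_0$, and let $N:M_0\to\mathbb{R}^{n-k+1}$ be a (unit normal) Gauss map. Consider the immersion $\varphi:S^k\times M_0\to M\subset S^{n+1}\subset\mathbb{R}^{n+2}$, $\varphi(y,m)=(\sqrt{1-|m|^2}\,y,\,m)$. Fix $m\in M_0$ and let $\{v_1,\dots,v_{n-k}\}$ be an orthonormal basis of $T_mM_0$ with $dN_m(v_i)=-\kappa_i v_i$. Put $f=\sqrt{1-|m|^2}$, $g=N(m)\cdot m$ and $h=\sqrt{1-(N(m)\cdot m)^2}$. Then, at every point $p=(y,m)$ with $y\in S^k$, $$d\varphi_p(v_i)=\left(-\frac{v_i\cdot m}{f}\,y,\; v_i\right),\qquad i=1,\dots,n-k.$$ Moreover, if $H$ is the mean curvature of $M$ (at $(y,m)$, with respect to the Gauss map $\xi$ given in the context) and $H_0$ is the mean curvature of $M_0$ (at $m$, with respect to $N$), then $$nH=\frac{ng+(n-k)H_0}{h}-\frac{1}{h^3}\sum_{i=1}^{n-k}\kappa_i\,(v_i\cdot m)^2 .$$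
   Context: $S^k$ is the unit sphere of $\mathbb{R}^{k+1}$ and $\cdot$ is the Euclidean inner product. A vector $v_i\in T_mM_0$ is regarded as the tangent vector $(0,v_i)$ of $S^k\times M_0$ at $(y,m)$. The Gauss map of the immersion $\varphi$ (defined on $S^k\times M_0$; unit, tangent to $S^{n+1}$ and normal to $\varphi$) is $$\xi(y,m)=\frac{1}{\sqrt{1-(N(m)\cdot m)^2}}\left(-(N(m)\cdot m)\sqrt{1-|m|^2}\,y,\;-(N(m)\cdot m)\,m+N(m)\right).$$ The principal curvatures of $M_0$ are the eigenvalues $\kappa_i$ of $-dN_m$, and $(n-k)H_0=\kappa_1+\dots+\kappa_{n-k}$. The principal curvatures of $M$ at $p=(y,m)$ are the eigenvalues $\lambda$ defined by $-d\xi_p(w)=\lambda\,d\varphi_p(w)$ for some $w\neq0$, and $nH$ is their sum counted with multiplicity, i.e. the trace of the shape operator $d\varphi_p(w)\mapsto -d\xi_p(w)$. *)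

theory Defs
  imports "HOL-Analysis.Analysis"
begin

(* Meant for open S: f is C^(r+1) iff it is differentiable and each of its directional
   derivatives is C^r; finitely many directions suffice as the domain is Euclidean. *)
primrec Ck_on :: "nat \<Rightarrow> ('a::euclidean_space \<Rightarrow> 'b::real_normed_vector) \<Rightarrow> 'a set \<Rightarrow> bool" where
  "Ck_on 0 f S \<longleftrightarrow> continuous_on S f"
| "Ck_on (Suc r) f S \<longleftrightarrow>
     (\<forall>x\<in>S. f differentiable (at x)) \<and>
     (\<forall>v. Ck_on r (\<lambda>x. frechet_derivative f (at x) v) S)"

definition smooth_on :: "('a::euclidean_space \<Rightarrow> 'b::real_normed_vector) \<Rightarrow> 'a set \<Rightarrow> bool" where
  "smooth_on f S \<longleftrightarrow> (\<forall>r. Ck_on r f S)"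

(* Smoothness on an arbitrary subset X of Euclidean space, via local smooth extensions. *)
definition smooth_map_on :: "('a::euclidean_space \<Rightarrow> 'b::real_normed_vector) \<Rightarrow> 'a set \<Rightarrow> bool" where
  "smooth_map_on f X \<longleftrightarrow>
     (\<forall>p\<in>X. \<exists>U g. open U \<and> p \<in> U \<and> smooth_on g U \<and> (\<forall>x\<in>U \<inter> X. g x = f x))"

(* Slice charts: locally X is straightened to a hyperplane by an ambient diffeomorphism. *)
definition smooth_hypersurface :: "'a::euclidean_space set \<Rightarrow> bool" where
  "smooth_hypersurface X \<longleftrightarrow>
     (\<forall>p\<in>X. \<exists>U V \<Phi> \<Psi> b.
        open U \<and> p \<in> U \<and> open (V :: 'a set) \<and> b \<noteq> (0 :: 'a) \<and>
        homeomorphism U V \<Phi> \<Psi> \<and> smooth_on \<Phi> U \<and> smooth_on \<Psi> V \<and>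
        \<Phi> ` (U \<inter> X) = V \<inter> {x. b \<bullet> x = 0})"

definition tangent_space :: "'a::euclidean_space set \<Rightarrow> 'a \<Rightarrow> 'a set" where
  "tangent_space X p =
     {v. \<exists>(\<gamma> :: real \<Rightarrow> 'a) e. e > 0 \<and> smooth_on \<gamma> {-e<..<e} \<and> \<gamma> ` {-e<..<e} \<subseteq> X \<and>
           \<gamma> 0 = p \<and> (\<gamma> has_vector_derivative v) (at 0)}"

definition gauss_map :: "'a::euclidean_space set \<Rightarrow> ('a \<Rightarrow> 'a) \<Rightarrow> bool" where
  "gauss_map X N \<longleftrightarrow>
     smooth_map_on N X \<and>
     (\<forall>p\<in>X. norm (N p) = 1 \<and> (\<forall>v\<in>tangent_space X p. N p \<bullet> v = 0))"

definition orientable_hypersurface :: "'a::euclidean_space set \<Rightarrow> bool" where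
  "orientable_hypersurface X \<longleftrightarrow> smooth_hypersurface X \<and> (\<exists>N. gauss_map X N)"

(* The differential at p of a map F defined on X.  The derivative within X is determined on
   tangent_space X p (by differentiating along curves in X), but in general not on other
   vectors, so it is only to be applied to tangent vectors. *)
definition differential ::
  "'a::euclidean_space set \<Rightarrow> ('a \<Rightarrow> 'b::euclidean_space) \<Rightarrow> 'a \<Rightarrow> 'a \<Rightarrow> 'b" where
  "differential X F p = frechet_derivative F (at p within X)"

(* Trace of a linear endomorphism A of the subspace V (A is irrelevant outside V);
   the choice of the basis B does not matter. *)
definition trace_on :: "'a::euclidean_space set \<Rightarrow> ('a \<Rightarrow> 'a) \<Rightarrow> real" where
  "trace_on V A =
     (let B = (SOME B. independent B \<and> span B = V) in \<Sum>b\<in>B. representation B (A b) b)"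

definition tangent_image ::
  "'a::euclidean_space set \<Rightarrow> ('a \<Rightarrow> 'b::euclidean_space) \<Rightarrow> 'a \<Rightarrow> 'b set" where
  "tangent_image X F p = differential X F p ` tangent_space X p"

(* For an immersion F of X with unit normal field \<nu>: the map sending dF_p(w) to -d\<nu>_p(w),
   for w tangent to X at p. *)
definition shape_operator ::
  "'a::euclidean_space set \<Rightarrow> ('a \<Rightarrow> 'b::euclidean_space) \<Rightarrow> ('a \<Rightarrow> 'b) \<Rightarrow> 'a \<Rightarrow> 'b \<Rightarrow> 'b" where
  "shape_operator X F \<nu> p u =
     - differential X \<nu> p (inv_into (tangent_space X p) (differential X F p) u)"

definition mean_curvature ::
  "'a::euclidean_space set \<Rightarrow> ('a \<Rightarrow> 'b::euclidean_space) \<Rightarrow> ('a \<Rightarrow> 'b) \<Rightarrow> 'a \<Rightarrow> real" where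
  "mean_curvature X F \<nu> p =
     trace_on (tangent_image X F p) (shape_operator X F \<nu> p) / real (dim (tangent_image X F p))"

definition phi :: "'a::euclidean_space \<times> 'b::euclidean_space \<Rightarrow> 'a \<times> 'b" where
  "phi = (\<lambda>(y, m). (sqrt (1 - (norm m)\<^sup>2) *\<^sub>R y, m))"

definition xi ::
  "('b::euclidean_space \<Rightarrow> 'b) \<Rightarrow> 'a::euclidean_space \<times> 'b \<Rightarrow> 'a \<times> 'b" where
  "xi N = (\<lambda>(y, m). (1 / sqrt (1 - (N m \<bullet> m)\<^sup>2)) *\<^sub>R
     ((- (N m \<bullet> m) * sqrt (1 - (norm m)\<^sup>2)) *\<^sub>R y, (- (N m \<bullet> m)) *\<^sub>R m + N m))"

end

theory Submission
  imports Defs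
begin

text \<open>The tangent space of \<open>S\<^sup>k \<times> M\<^sub>0\<close> at \<open>(y, m)\<close> is \<open>y\<^sup>\<bottom> \<times> T\<^sub>m M\<^sub>0\<close>. On vectors \<open>(u, 0)\<close> the
  shape operator is multiplication by \<open>g / h\<close>. On the \<open>(0, v\<^sub>i)\<close>, writing \<open>a\<^sub>i = v\<^sub>i \<bullet> m\<close> and using
  \<open>m = g N + \<Sum>\<^sub>j a\<^sub>j v\<^sub>j\<close>, its matrix is \<open>\<delta>\<^sub>i\<^sub>j (g + \<kappa>\<^sub>i) / h - \<kappa>\<^sub>i a\<^sub>i a\<^sub>j / h\<^sup>3\<close>. The formula is the trace
  of this block diagonal operator.\<close>

section \<open>Closure properties of \<open>Ck_on\<close>\<close>

text \<open>On an open set equal functions have equal derivatives, so equality passes to every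
  directional derivative and the induction goes through. This lets \<open>frechet_derivative\<close>
  be replaced by an explicit formula that is known only on \<open>S\<close>.\<close>

lemma Ck_on_cong:
  assumes "open S" "\<And>x. x \<in> S \<Longrightarrow> f x = g x" "Ck_on r f S"
  shows "Ck_on r g S"
  using assms(2,3)
proof (induction r arbitrary: f g)
  case 0
  then show ?case by (metis Ck_on.simps(1) continuous_on_cong)
next
  case (Suc r)
  have d: "f differentiable (at x)" if "x \<in> S" for x
    using Suc.prems(2) that by simp
  have eq: "frechet_derivative f (at x) = frechet_derivative g (at x)" if "x \<in> S" for x
    by (rule frechet_derivative_transform_within_open[OF d[OF that] \<open>open S\<close> that Suc.prems(1)])
  have "g differentiable (at x)" if "x \<in> S" for x
    using d[OF that] unfolding differentiable_def
    by (auto intro: has_derivative_transform_within_open[OF _ \<open>open S\<close> that Suc.prems(1)])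
  moreover have "Ck_on r (\<lambda>x. frechet_derivative g (at x) w) S" for w
    using Suc.IH[of "\<lambda>x. frechet_derivative f (at x) w"] eq Suc.prems(2) by simp
  ultimately show ?case by simp
qed

lemma Ck_on_subset: "Ck_on r f S \<Longrightarrow> T \<subseteq> S \<Longrightarrow> Ck_on r f T"
  by (induction r arbitrary: f) (auto intro: continuous_on_subset)

lemma Ck_on_bounded_linear_compose:
  assumes "bounded_linear L" "open S" "Ck_on r f S"
  shows "Ck_on r (\<lambda>x. L (f x)) S"
  using assms(3)
proof (induction r arbitrary: f)
  case 0
  then show ?case
    using bounded_linear.continuous_on[OF assms(1)] by simp
next
  case (Suc r)
  have d: "((\<lambda>x. L (f x)) has_derivative (\<lambda>w. L (frechet_derivative f (at x) w))) (at x)"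
    if "x \<in> S" for x
    using Suc.prems that
    by (intro bounded_linear.has_derivative[OF assms(1)]) (simp flip: frechet_derivative_works)
  have "Ck_on r (\<lambda>x. L (frechet_derivative f (at x) w)) S" for w
    using Suc.IH Suc.prems by simp
  then have "Ck_on r (\<lambda>x. frechet_derivative (\<lambda>x. L (f x)) (at x) w) S" for w
    by (rule Ck_on_cong[OF \<open>open S\<close>, rotated]) (simp add: frechet_derivative_at[OF d, symmetric])
  then show ?case using d by (auto simp: differentiable_def)
qed

lemma Ck_on_Pair:
  assumes "open S" "Ck_on r f S" "Ck_on r g S"
  shows "Ck_on r (\<lambda>x. (f x, g x)) S"
  using assms(2,3)
proof (induction r arbitrary: f g)
  case 0
  then show ?case by (simp add: continuous_on_Pair)
next
  case (Suc r)
  have d: "((\<lambda>x. (f x, g x)) has_derivative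
      (\<lambda>w. (frechet_derivative f (at x) w, frechet_derivative g (at x) w))) (at x)"
    if "x \<in> S" for x
    using Suc.prems that
    by (intro has_derivative_Pair) (simp_all flip: frechet_derivative_works)
  have "Ck_on r (\<lambda>x. (frechet_derivative f (at x) w, frechet_derivative g (at x) w)) S" for w
    using Suc.IH Suc.prems by simp
  then have "Ck_on r (\<lambda>x. frechet_derivative (\<lambda>x. (f x, g x)) (at x) w) S" for w
    by (rule Ck_on_cong[OF \<open>open S\<close>, rotated]) (simp add: frechet_derivative_at[OF d, symmetric])
  then show ?case using d by (auto simp: differentiable_def)
qed

text \<open>The family is closed under directional derivatives: the pair of coefficients
  \<open>a\<close>, \<open>b\<close> turns into a multiple of \<open>b\<close>, \<open>- a\<close>.
  This is why both are left arbitrary in the induction.\<close>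

lemma Ck_on_cos_sin: "Ck_on r (\<lambda>t::real. cos (c * t) *\<^sub>R a + sin (c * t) *\<^sub>R b) UNIV"
proof (induction r arbitrary: a b)
  case 0
  show ?case by (auto intro!: continuous_intros)
next
  case (Suc r)
  have d: "((\<lambda>t::real. cos (c * t) *\<^sub>R a + sin (c * t) *\<^sub>R b) has_derivative
      (\<lambda>w. cos (c * t) *\<^sub>R ((w * c) *\<^sub>R b) + sin (c * t) *\<^sub>R (- (w * c) *\<^sub>R a))) (at t)" for t
    by (auto intro!: derivative_eq_intros simp: algebra_simps)
  have "frechet_derivative (\<lambda>t::real. cos (c * t) *\<^sub>R a + sin (c * t) *\<^sub>R b) (at t)
      = (\<lambda>w. cos (c * t) *\<^sub>R ((w * c) *\<^sub>R b) + sin (c * t) *\<^sub>R (- (w * c) *\<^sub>R a))" for t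
    using frechet_derivative_at[OF d] by simp
  then have "Ck_on r (\<lambda>t. frechet_derivative
      (\<lambda>t::real. cos (c * t) *\<^sub>R a + sin (c * t) *\<^sub>R b) (at t) w) UNIV" for w
    using Suc.IH[of "(w * c) *\<^sub>R b" "- (w * c) *\<^sub>R a"] by simp
  then show ?case using d by (auto simp: differentiable_def)
qed

section \<open>Tangent space of the product of a sphere with \<open>M\<close>\<close>

text \<open>The curve is the great circle through \<open>y\<close> towards \<open>u\<close>, run at
  speed \<open>norm u\<close>, because \<open>norm u *\<^sub>R sgn u = u\<close>. Since
  \<open>sgn 0 = 0\<close>, the same formula gives the constant curve when
  \<open>u = 0\<close>.\<close>

lemma great_circle_curve:
  fixes y :: "'a::euclidean_space"
  assumes y: "norm y = 1" and uy: "y \<bullet> u = 0"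
  obtains \<gamma> :: "real \<Rightarrow> 'a" where "smooth_on \<gamma> UNIV" "range \<gamma> \<subseteq> sphere 0 1" "\<gamma> 0 = y"
    "(\<gamma> has_vector_derivative u) (at 0)"
proof
  define \<gamma> where "\<gamma> = (\<lambda>t. cos (norm u * t) *\<^sub>R y + sin (norm u * t) *\<^sub>R sgn u)"
  show "smooth_on \<gamma> UNIV"
    unfolding smooth_on_def \<gamma>_def using Ck_on_cos_sin by blast
  have "\<gamma> t \<in> sphere 0 1" for t
  proof (cases "u = 0")
    case True
    then show ?thesis using y by (simp add: \<gamma>_def)
  next
    case False
    have "y \<bullet> y = 1" "sgn u \<bullet> sgn u = 1"
      using y False by (simp_all add: norm_eq_1[symmetric] norm_sgn)
    moreover have "y \<bullet> sgn u = 0"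
      using uy by (simp add: sgn_div_norm)
    ultimately have "\<gamma> t \<bullet> \<gamma> t = (cos (norm u * t))\<^sup>2 + (sin (norm u * t))\<^sup>2"
      by (simp add: \<gamma>_def inner_add inner_commute power2_eq_square)
    then show ?thesis by (simp add: norm_eq_1)
  qed
  then show "range \<gamma> \<subseteq> sphere 0 1" by blast
  show "\<gamma> 0 = y" by (simp add: \<gamma>_def)
  show "(\<gamma> has_vector_derivative u) (at 0)"
    unfolding \<gamma>_def has_vector_derivative_def
    by (cases "u = 0") (auto intro!: derivative_eq_intros simp: sgn_div_norm fun_eq_iff)
qed

text \<open>A curve in the product has a first component of constant norm 1; differentiating its
  square at 0 gives orthogonality to \<open>y\<close>. Conversely, a curve in \<open>M\<close> is
  paired with a great circle.\<close>

lemma tangent_space_sphere_Times: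
  fixes y :: "'a::euclidean_space" and M :: "'b::euclidean_space set"
  assumes y: "norm y = 1"
  shows "tangent_space (sphere 0 1 \<times> M) (y, m) = {u. y \<bullet> u = 0} \<times> tangent_space M m"
proof (intro subset_antisym subsetI)
  fix p assume "p \<in> tangent_space (sphere (0::'a) 1 \<times> M) (y, m)"
  then obtain \<gamma> e where e: "e > 0" and sm: "smooth_on \<gamma> {-e<..<e}"
    and im: "\<gamma> ` {-e<..<e} \<subseteq> sphere (0::'a) 1 \<times> M" and g0: "\<gamma> 0 = (y, m)"
    and d: "(\<gamma> has_vector_derivative p) (at 0)"
    unfolding tangent_space_def by blast
  have d1: "((\<lambda>t. fst (\<gamma> t)) has_derivative (\<lambda>t. t *\<^sub>R fst p)) (at 0)"
    using has_derivative_fst[OF d[unfolded has_vector_derivative_def]] by simp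
  have d2: "((\<lambda>t. snd (\<gamma> t)) has_vector_derivative snd p) (at 0)"
    using has_derivative_snd[OF d[unfolded has_vector_derivative_def]]
    by (simp add: has_vector_derivative_def)
  have "((\<lambda>t. fst (\<gamma> t) \<bullet> fst (\<gamma> t)) has_derivative (\<lambda>t. t * (2 * (y \<bullet> fst p)))) (at 0)"
    using has_derivative_inner[OF d1 d1] g0 by (simp add: inner_commute algebra_simps)
  moreover have "((\<lambda>t. fst (\<gamma> t) \<bullet> fst (\<gamma> t)) has_derivative (\<lambda>t. 0)) (at 0)"
  proof (rule has_derivative_transform_within_open[of "\<lambda>t. 1" _ _ _ "{-e<..<e}"])
    show "1 = fst (\<gamma> t) \<bullet> fst (\<gamma> t)" if "t \<in> {-e<..<e}" for t
      using im that by (force simp: norm_eq_1[symmetric] image_subset_iff mem_Times_iff)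
  qed (use e in auto)
  ultimately have "(\<lambda>t. t * (2 * (y \<bullet> fst p))) = (\<lambda>t. 0)"
    using has_derivative_unique by blast
  from fun_cong[OF this, of 1] have "y \<bullet> fst p = 0" by simp
  moreover have "snd p \<in> tangent_space M m"
    unfolding tangent_space_def mem_Collect_eq
  proof (intro exI conjI)
    show "smooth_on (\<lambda>t. snd (\<gamma> t)) {-e<..<e}"
      using sm by (simp add: smooth_on_def Ck_on_bounded_linear_compose[OF bounded_linear_snd])
  qed (use e im g0 d2 in auto)
  ultimately show "p \<in> {u. y \<bullet> u = 0} \<times> tangent_space M m"
    by (simp add: mem_Times_iff)
next
  fix p assume p: "p \<in> {u. y \<bullet> u = 0} \<times> tangent_space M m"
  then obtain \<gamma> e where e: "e > 0" and sm: "smooth_on \<gamma> {-e<..<e}"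
    and im: "\<gamma> ` {-e<..<e} \<subseteq> M" and g0: "\<gamma> 0 = m"
    and d: "(\<gamma> has_vector_derivative snd p) (at 0)"
    unfolding tangent_space_def by (auto simp: mem_Times_iff)
  from p have "y \<bullet> fst p = 0" by (simp add: mem_Times_iff)
  from great_circle_curve[OF y this] obtain c where c: "smooth_on c UNIV"
    "range c \<subseteq> sphere 0 1" "c 0 = y" "(c has_vector_derivative fst p) (at 0)" .
  show "p \<in> tangent_space (sphere 0 1 \<times> M) (y, m)"
    unfolding tangent_space_def mem_Collect_eq
  proof (intro exI conjI)
    show "smooth_on (\<lambda>t. (c t, \<gamma> t)) {-e<..<e}"
      using sm c(1) by (auto simp: smooth_on_def intro!: Ck_on_Pair intro: Ck_on_subset)
    show "((\<lambda>t. (c t, \<gamma> t)) has_vector_derivative p) (at 0)"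
      using has_vector_derivative_Pair[OF c(4) d] by simp
  qed (use e im g0 c in auto)
qed

section \<open>Differentials along curves\<close>

text \<open>The derivative within \<open>X\<close> need not be unique, but composing with a curve in \<open>X\<close> that realizes
  \<open>w\<close> determines its value at \<open>w\<close>.\<close>
lemma differential_eq:
  assumes D: "(F has_derivative D) (at p within X)" and w: "w \<in> tangent_space X p"
  shows "differential X F p w = D w"
proof -
  obtain \<gamma> e where e: "e > 0" and im: "\<gamma> ` {-e<..<e} \<subseteq> X" and g0: "\<gamma> 0 = p"
    and d: "(\<gamma> has_vector_derivative w) (at 0)"
    using w unfolding tangent_space_def by blast
  have chain: "((F \<circ> \<gamma>) has_vector_derivative G w) (at (0::real))"
    if G: "(F has_derivative G) (at p within X)" for G
  proof -
    have "((F \<circ> \<gamma>) has_vector_derivative G w) (at 0 within {-e<..<e})"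
    proof (rule vector_derivative_diff_chain_within)
      show "(\<gamma> has_vector_derivative w) (at 0 within {-e<..<e})"
        using d by (rule has_vector_derivative_at_within)
      show "(F has_derivative G) (at (\<gamma> 0) within \<gamma> ` {-e<..<e})"
        unfolding g0 using G im by (rule has_derivative_subset)
    qed
    then show ?thesis using e at_within_open[of 0 "{-e<..<e}"] by simp
  qed
  \<comment> \<open>Existence of \<open>D\<close> makes the choice behind
    \<open>differential\<close> a genuine derivative, possibly another one than \<open>D\<close>.
    Both must give the unique derivative of \<open>F \<circ> \<gamma>\<close> at 0.\<close>
  have "(F has_derivative differential X F p) (at p within X)"
    using D unfolding differential_def
    by (auto simp: differentiable_def simp flip: frechet_derivative_works)
  from vector_derivative_unique_at[OF chain[OF this] chain[OF D]] show ?thesis .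
qed

section \<open>Traces and mean curvature in a frame\<close>

text \<open>For two bases \<open>B\<close> and \<open>C\<close> of \<open>V\<close>, both diagonal sums equal the double sum of
  \<^term>\<open>representation C b c * representation B (A c) b\<close>.\<close>
lemma trace_on_eq:
  fixes A :: "'a::euclidean_space \<Rightarrow> 'a"
  assumes "subspace V" and A: "A \<in> V \<rightarrow> V"
    and add: "\<And>x y. x \<in> V \<Longrightarrow> y \<in> V \<Longrightarrow> A (x + y) = A x + A y"
    and scale: "\<And>c x. x \<in> V \<Longrightarrow> A (c *\<^sub>R x) = c *\<^sub>R A x"
    and C: "independent C" "span C = V"
  shows "trace_on V A = (\<Sum>c\<in>C. representation C (A c) c)"
proof -
  define B where "B = (SOME B. independent B \<and> span B = V)"
  have B: "independent B" "span B = V"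
    unfolding B_def using C someI[of "\<lambda>B. independent B \<and> span B = V" C] by blast+
  have fin: "finite B" "finite C"
    using B(1) C(1) by (simp_all add: independent_imp_finite)
  have BV: "b \<in> V" if "b \<in> B" for b using B that span_base by blast
  have CV: "c \<in> V" if "c \<in> C" for c using C that span_base by blast
  have A0: "A 0 = 0" using scale[of 0 0] subspace_0[OF \<open>subspace V\<close>] by simp
  \<comment> \<open>\<open>A\<close> is linear only on \<open>V\<close>, so the induction keeps
    every partial sum inside \<open>V\<close>.\<close>
  have A_sum: "A (\<Sum>i\<in>I. x i) = (\<Sum>i\<in>I. A (x i))" if "finite I" "\<And>i. i \<in> I \<Longrightarrow> x i \<in> V"
    for I :: "'a set" and x
    using that by (induction I rule: finite_induct)
      (auto simp: A0 add subspace_sum[OF \<open>subspace V\<close>])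
  have 1: "representation B (A b) b = (\<Sum>c\<in>C. representation C b c * representation B (A c) b)"
    if "b \<in> B" for b
  proof -
    have "A b = A (\<Sum>c\<in>C. representation C b c *\<^sub>R c)"
      using sum_representation_eq[of C b C] C fin BV that by simp
    also have "\<dots> = (\<Sum>c\<in>C. representation C b c *\<^sub>R A c)"
      using A_sum[OF fin(2)] CV scale subspace_scale[OF \<open>subspace V\<close>] by simp
    finally show ?thesis
      using A CV B by (auto simp: representation_sum representation_scale span_scale Pi_iff)
  qed
  have 2: "representation C (A c) c = (\<Sum>b\<in>B. representation C b c * representation B (A c) b)"
    if "c \<in> C" for c
  proof -
    have Ac: "A c \<in> V" using A CV that by blast
    have "representation C (A c) c = representation C (\<Sum>b\<in>B. representation B (A c) b *\<^sub>R b) c"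
      using sum_representation_eq[of B "A c" B] B fin Ac by simp
    then show ?thesis
      using BV C \<open>subspace V\<close>
      by (simp add: representation_sum representation_scale subspace_scale mult.commute)
  qed
  have "trace_on V A = (\<Sum>b\<in>B. representation B (A b) b)"
    by (simp add: trace_on_def B_def Let_def)
  also have "\<dots> = (\<Sum>c\<in>C. representation C (A c) c)"
    by (simp add: 1 2 sum.swap[of _ B C])
  finally show ?thesis .
qed

text \<open>A spanning family with as many indices as the dimension is a basis of the tangent space.
  The injective \<open>DF\<close> carries it to a basis of the tangent image, and there
  \<open>a\<close> is the matrix of the shape operator. The index type is free so that a sum type
  can index a frame of a product.\<close>

lemma mean_curvature_eq:
  fixes F \<nu> :: "'a::euclidean_space \<Rightarrow> 'b::euclidean_space" and e :: "'i \<Rightarrow> 'a"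
  assumes F: "(F has_derivative DF) (at p within X)"
    and \<nu>: "(\<nu> has_derivative D\<nu>) (at p within X)"
    and inj: "inj DF"
    and I: "finite I" "dim (tangent_space X p) = card I" "span (e ` I) = tangent_space X p"
    and a: "\<And>i. i \<in> I \<Longrightarrow> - D\<nu> (e i) = (\<Sum>j\<in>I. a i j *\<^sub>R DF (e j))"
  shows "mean_curvature X F \<nu> p = (\<Sum>i\<in>I. a i i) / real (card I)"
proof -
  define T where "T = tangent_space X p"
  define V where "V = tangent_image X F p"
  define S where "S = shape_operator X F \<nu> p"
  have lin: "linear DF" "linear D\<nu>"
    using F \<nu> has_derivative_linear by blast+
  have T: "subspace T" "span (e ` I) = T" "dim T = card I"
    using I by (auto simp: T_def) (metis subspace_span)
  have eT: "e i \<in> T" if "i \<in> I" for i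
    using span_base[of "e i" "e ` I"] that T(2) by simp
  have dF: "differential X F p w = DF w" "differential X \<nu> p w = D\<nu> w" if "w \<in> T" for w
    using differential_eq[OF F] differential_eq[OF \<nu>] that by (simp_all add: T_def)
  have V: "V = DF ` T"
    using dF by (simp add: V_def tangent_image_def T_def[symmetric])
  have S: "S (DF w) = - D\<nu> w" if "w \<in> T" for w
  proof -
    have "inj_on (differential X F p) T"
      using dF inj by (auto simp: inj_on_def)
    then have "inv_into T (differential X F p) (DF w) = w"
      using dF that by (metis inv_into_f_f)
    then show ?thesis using dF that by (simp add: S_def shape_operator_def T_def[symmetric])
  qed
  \<comment> \<open>A spanning set has at least \<open>dim T = card I\<close> elements, so
    \<open>e\<close> repeats no vector and its image is a basis.\<close>
  have "card (e ` I) = card I"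
    using card_image_le[OF I(1), of e] dim_le_card[of T "e ` I"] T I(1) by simp
  then have inj_e: "inj_on e I" using I(1) by (simp add: eq_card_imp_inj_on)
  have ind_e: "independent (e ` I)"
    using card_eq_dim[of "e ` I" T] T I(1) eT \<open>card (e ` I) = card I\<close> by auto
  define C where "C = (DF \<circ> e) ` I"
  have C: "independent C" "span C = V"
    using linear_independent_injective_image[OF lin(1) ind_e] inj
      linear_span_image[OF lin(1), of "e ` I"] T
    by (auto simp: C_def V image_comp inj_on_subset)
  have inj_C: "inj_on (DF \<circ> e) I"
    using inj_e inj by (simp add: comp_inj_on inj_on_subset)
  have rep: "representation C (S (DF (e i))) (DF (e i)) = a i i" if i: "i \<in> I" for i
  proof -
    have mem: "DF (e j) \<in> C" if "j \<in> I" for j using that by (auto simp: C_def)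
    have "S (DF (e i)) = (\<Sum>j\<in>I. a i j *\<^sub>R DF (e j))"
      using S a eT i by simp
    then have "representation C (S (DF (e i))) (DF (e i))
        = (\<Sum>j\<in>I. a i j * (if DF (e i) = DF (e j) then 1 else 0))"
      using C(1) mem
      by (simp add: representation_sum representation_scale span_scale span_base
          representation_basis)
    also have "\<dots> = (\<Sum>j\<in>I. if i = j then a i j else 0)"
      using inj_on_eq_iff[OF inj_C i] by (intro sum.cong) auto
    finally show ?thesis using i I(1) by simp
  qed
  have "trace_on V S = (\<Sum>c\<in>C. representation C (S c) c)"
  proof (rule trace_on_eq)
    show "subspace V" using C by (metis subspace_span)
    \<comment> \<open>It suffices to check the spanning vectors \<open>e i\<close>, for which the
      matrix equation exhibits an element of \<open>V\<close>.\<close>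
    have "- D\<nu> w \<in> V" if "w \<in> T" for w
    proof -
      have "linear (\<lambda>w. - D\<nu> w)" using lin(2) by (simp add: linear_compose_neg)
      then have "(\<lambda>w. - D\<nu> w) ` T = span ((\<lambda>w. - D\<nu> w) ` e ` I)"
        using linear_span_image[of "\<lambda>w. - D\<nu> w" "e ` I"] T(2) by simp
      also have "\<dots> \<subseteq> V"
      proof (rule span_minimal[OF _ \<open>subspace V\<close>])
        have "DF (e j) \<in> V" if "j \<in> I" for j
          using eT that V by blast
        then show "(\<lambda>w. - D\<nu> w) ` e ` I \<subseteq> V"
          using a by (auto intro!: subspace_sum subspace_scale \<open>subspace V\<close>)
      qed
      finally show ?thesis using that by blast
    qed
    then show "S \<in> V \<rightarrow> V" using S V by auto
    show "S (x + x') = S x + S x'" if x: "x \<in> V" "x' \<in> V" for x x'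
    proof -
      obtain w w' where w: "w \<in> T" "w' \<in> T" "x = DF w" "x' = DF w'"
        using x V by blast
      moreover have "S (DF (w + w')) = - D\<nu> (w + w')" 
        using w T(1) by (intro S subspace_add)
      ultimately show ?thesis using S lin by (simp add: linear_add)
    qed
    show "S (c *\<^sub>R x) = c *\<^sub>R S x" if x: "x \<in> V" for c x
    proof -
      obtain w where w: "w \<in> T" "x = DF w"
        using x V by blast
      moreover have "S (DF (c *\<^sub>R w)) = - D\<nu> (c *\<^sub>R w)" 
        using w T(1) by (intro S subspace_scale)
      ultimately show ?thesis using S lin by (simp add: linear_scale)
    qed
  qed (use C in auto)
  also have "\<dots> = (\<Sum>i\<in>I. a i i)"
    unfolding C_def by (subst sum.reindex[OF inj_C]) (auto simp: rep[unfolded C_def comp_def] comp_def)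
  finally have "trace_on V S = (\<Sum>i\<in>I. a i i)" .
  moreover have "dim V = card I"
    using dim_image_eq[OF lin(1), of T] inj T(3) by (simp add: V inj_on_subset)
  ultimately show ?thesis
    by (simp add: mean_curvature_def V_def S_def)
qed

section \<open>Derivatives of smooth maps, of \<open>phi\<close> and of \<open>xi\<close>\<close>

text \<open>A local smooth extension is differentiable at \<open>p\<close> and agrees with
  \<open>F\<close> on \<open>X\<close> near \<open>p\<close>, so its derivative is one of
  \<open>F\<close> within \<open>X\<close>; hence the derivative chosen by
  \<open>differential\<close> is genuine.\<close>

lemma smooth_map_on_has_derivative:
  assumes "smooth_map_on F X" "p \<in> X"
  shows "(F has_derivative differential X F p) (at p within X)"
proof -
  obtain U G where U: "open U" "p \<in> U" "smooth_on G U" "\<forall>x\<in>U \<inter> X. G x = F x"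
    using assms(1)[unfolded smooth_map_on_def, rule_format, OF assms(2)] by (elim exE conjE)
  have "Ck_on (Suc 0) G U"
    using U(3) unfolding smooth_on_def by blast
  then have "G differentiable (at p)"
    using U(2) by simp
  then obtain D where "(G has_derivative D) (at p within X)"
    unfolding differentiable_def using has_derivative_at_withinI by blast
  moreover obtain d where "d > 0" "ball p d \<subseteq> U"
    using U(1,2) by (rule openE)
  ultimately have "(F has_derivative D) (at p within X)"
    using U(4) \<open>p \<in> X\<close>
    by (elim has_derivative_transform_within[of _ _ _ _ d])
      (auto simp: dist_commute mem_ball subset_iff)
  then show ?thesis
    unfolding differential_def
    by (auto simp: differentiable_def simp flip: frechet_derivative_works)
qed

lemma has_derivative_phi:
  fixes p :: "'a::euclidean_space \<times> 'b::euclidean_space"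
  assumes "norm (snd p) < 1"
  defines "f \<equiv> sqrt (1 - (norm (snd p))\<^sup>2)"
  shows "(phi has_derivative (\<lambda>(u, w). (- ((w \<bullet> snd p) / f) *\<^sub>R fst p + f *\<^sub>R u, w)))
    (at p within X)"
proof -
  have "(norm (snd p))\<^sup>2 < 1"
    using assms(1) by (simp add: power_less_one_iff)
  then have pos: "0 < 1 - snd p \<bullet> snd p" by (simp add: power2_norm_eq_inner)
  show ?thesis
    \<comment> \<open>As an inner product the squared norm can be differentiated also at the origin,
      where the norm itself cannot.\<close>
    unfolding phi_def f_def case_prod_unfold power2_norm_eq_inner
    by (rule derivative_eq_intros refl pos)+ (auto simp: fun_eq_iff inner_commute field_simps)
qed

lemma DERIV_inverse_sqrt_one_minus_square:
  assumes "0 < 1 - (t::real)\<^sup>2"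
  shows "DERIV (\<lambda>t. 1 / sqrt (1 - t\<^sup>2)) t :> t / sqrt (1 - t\<^sup>2) ^ 3"
proof -
  have "sqrt (1 - t\<^sup>2) \<noteq> 0" using assms by simp
  with assms show ?thesis
    by (auto intro!: derivative_eq_intros simp: field_simps power2_eq_square power3_eq_cube)
qed

text \<open>This is the product rule applied to the factors \<open>g\<close>, \<open>f\<close> and
  \<open>1 / h\<close>, with \<open>dg\<close> the differential of \<open>g\<close> and
  \<open>g * dg w / h ^ 3\<close> that of \<open>1 / h\<close>.\<close>

lemma has_derivative_xi:
  fixes p :: "'a::euclidean_space \<times> 'b::euclidean_space"
  assumes N: "(N has_derivative N') (at (snd p) within snd ` X)"
    and p: "norm (snd p) < 1" and g1: "\<bar>N (snd p) \<bullet> snd p\<bar> < 1"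
  defines "f \<equiv> sqrt (1 - (norm (snd p))\<^sup>2)" and "g \<equiv> N (snd p) \<bullet> snd p"
    and "h \<equiv> sqrt (1 - (N (snd p) \<bullet> snd p)\<^sup>2)"
    and "dg \<equiv> \<lambda>w. N' w \<bullet> snd p + N (snd p) \<bullet> w"
  shows "(xi N has_derivative (\<lambda>(u, w).
     (((g * (w \<bullet> snd p) / f - f * dg w) / h - g\<^sup>2 * f * dg w / h ^ 3) *\<^sub>R fst p
         - (g * f / h) *\<^sub>R u,
      (g * dg w / h ^ 3) *\<^sub>R (N (snd p) - g *\<^sub>R snd p)
         + (1 / h) *\<^sub>R (N' w - dg w *\<^sub>R snd p - g *\<^sub>R w)))) (at p within X)"
proof -
  have "(norm (snd p))\<^sup>2 < 1"
    using p by (simp add: power_less_one_iff)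
  then have pos: "0 < 1 - snd p \<bullet> snd p" by (simp add: power2_norm_eq_inner)
  have pos': "0 < 1 - (N (snd p) \<bullet> snd p)\<^sup>2" using g1 by (simp add: abs_square_less_1)
  then have h: "0 < h" "h\<^sup>2 = 1 - (N (snd p) \<bullet> snd p)\<^sup>2" by (auto simp: h_def)
  have f: "0 < f" using pos by (simp add: f_def power2_norm_eq_inner)
  have N1: "((\<lambda>q. N (snd q)) has_derivative (\<lambda>q. N' (snd q))) (at p within X)"
    using has_derivative_in_compose[OF has_derivative_snd[OF has_derivative_ident] N] .
  have df: "((\<lambda>q. sqrt (1 - (norm (snd q))\<^sup>2)) has_derivative (\<lambda>q. - (snd q \<bullet> snd p) / f))
      (at p within X)"
    unfolding f_def power2_norm_eq_inner
    by (rule derivative_eq_intros refl pos)+ (auto simp: fun_eq_iff inner_commute field_simps)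
  have dG: "((\<lambda>q. N (snd q) \<bullet> snd q) has_derivative (\<lambda>q. dg (snd q))) (at p within X)"
    unfolding dg_def by (rule derivative_eq_intros N1 refl)+ (auto simp: fun_eq_iff)
  have dH: "((\<lambda>q. 1 / sqrt (1 - (N (snd q) \<bullet> snd q)\<^sup>2)) has_derivative
      (\<lambda>q. g * dg (snd q) / h ^ 3)) (at p within X)"
    using DERIV_compose_FDERIV[OF DERIV_inverse_sqrt_one_minus_square[OF pos'] dG]
    by (simp add: g_def h_def mult.commute)
  \<comment> \<open>Naming the scalar factors keeps them opaque, so that the product rule uses the
    derivatives just computed instead of descending into the square roots.\<close>
  define Gp Fp Hp where "Gp = (\<lambda>q::'a \<times> 'b. N (snd q) \<bullet> snd q)"
    and "Fp = (\<lambda>q::'a \<times> 'b. sqrt (1 - (norm (snd q))\<^sup>2))"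
    and "Hp = (\<lambda>q::'a \<times> 'b. 1 / sqrt (1 - (N (snd q) \<bullet> snd q)\<^sup>2))"
  have xi: "xi N = (\<lambda>q. Hp q *\<^sub>R ((- (Gp q) * Fp q) *\<^sub>R fst q,
      (- (Gp q)) *\<^sub>R snd q + N (snd q)))"
    by (simp add: xi_def Gp_def Fp_def Hp_def case_prod_unfold)
  have val: "Gp p = g" "Fp p = f" "Hp p = 1 / h"
    by (simp_all add: Gp_def Fp_def Hp_def g_def f_def h_def)
  note d = dG[folded Gp_def] df[folded Fp_def] dH[folded Hp_def]
  show ?thesis
    unfolding xi
    by (rule derivative_eq_intros d N1 refl)+
      (auto simp: fun_eq_iff val algebra_simps power2_eq_square power3_eq_cube
        add_divide_distrib diff_divide_distrib)
qed

theorem proposition2p2: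
  fixes n k :: nat
    and M\<^sub>0 :: "'b::euclidean_space set"
    and N :: "'b \<Rightarrow> 'b"
    and m :: 'b
    and y :: "'a::euclidean_space"
    and v :: "nat \<Rightarrow> 'b"
    and \<kappa> :: "nat \<Rightarrow> real"
    and f g h H H\<^sub>0 :: real
  assumes "1 \<le> k" and "k < n"
    and "DIM('a) = k + 1" and "DIM('b) = n - k + 1"
    and "orientable_hypersurface M\<^sub>0"
    and "\<forall>x\<in>M\<^sub>0. norm x < 1"
    and "gauss_map M\<^sub>0 N"
    and "m \<in> M\<^sub>0"
    and "\<forall>i\<in>{1..n-k}. \<forall>j\<in>{1..n-k}. v i \<bullet> v j = (if i = j then 1 else 0)"
    and "span (v ` {1..n-k}) = tangent_space M\<^sub>0 m"
    and "\<forall>i\<in>{1..n-k}. differential M\<^sub>0 N m (v i) = - \<kappa> i *\<^sub>R v i"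
    and "f = sqrt (1 - (norm m)\<^sup>2)"
    and "g = N m \<bullet> m"
    and "h = sqrt (1 - (N m \<bullet> m)\<^sup>2)"
    and "y \<in> sphere 0 1"
    and "H = mean_curvature (sphere 0 1 \<times> M\<^sub>0) phi (xi N) (y, m)"
    and "H\<^sub>0 = mean_curvature M\<^sub>0 (\<lambda>x. x) N m"
  shows "(\<forall>i\<in>{1..n-k}. differential (sphere 0 1 \<times> M\<^sub>0) phi (y, m) (0, v i)
                          = (- ((v i \<bullet> m) / f) *\<^sub>R y, v i)) \<and>
         real n * H = (real n * g + real (n - k) * H\<^sub>0) / h
                        - 1 / h ^ 3 * (\<Sum>i=1..n-k. \<kappa> i * (v i \<bullet> m)\<^sup>2)"
proof -

  \<comment> \<open>An orthonormal frame at \<open>m\<close>\<close>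
  define I where "I = {1..n-k}"
  define T where "T = tangent_space M\<^sub>0 m"
  define X where "X = sphere (0::'a) 1 \<times> M\<^sub>0"
  define N' where "N' = differential M\<^sub>0 N m"
  define a where "a = (\<lambda>i. v i \<bullet> m)"
  have I: "finite I" "card I = n - k" by (simp_all add: I_def)
  note orth = assms(9)[folded I_def] and span_v = assms(10)[folded I_def T_def]
    and dN = assms(11)[folded I_def N'_def]
  note n = assms(2) and m = assms(8)
  note fgh = assms(12-14)
  have y: "norm y = 1" using assms(15) by simp
  have sub: "subspace T" using span_v by (metis subspace_span)
  have vT: "v i \<in> T" if "i \<in> I" for i
    using span_base[of "v i" "v ` I"] that span_v by simp
  have N_orth: "N m \<bullet> v i = 0" if "i \<in> I" for i
    using assms(7) m vT[OF that] by (auto simp: gauss_map_def T_def)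
  have norm_N: "norm (N m) = 1"
    using assms(7) m by (auto simp: gauss_map_def)
  have norm_m: "norm m < 1" using assms(6) m by blast
  \<comment> \<open>By Cauchy-Schwarz \<open>\<bar>g\<bar> \<le> norm m < 1\<close>; this makes
    \<open>h\<close> positive.\<close>
  have g1: "\<bar>g\<bar> < 1"
    using Cauchy_Schwarz_ineq2[of "N m" m] norm_N norm_m fgh(2) by simp
  have f: "0 < f" "f\<^sup>2 = 1 - (norm m)\<^sup>2" and h: "0 < h" "h\<^sup>2 = 1 - g\<^sup>2"
    using norm_m g1 fgh by (simp_all add: power_less_one_iff abs_square_less_1 less_imp_le)
  have inj_v: "inj_on v I"
  proof (rule inj_onI)
    fix i j assume ij: "i \<in> I" "j \<in> I" "v i = v j"
    then have "v i \<bullet> v j = 1" using orth by metis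
    then show "i = j" using orth ij by (metis zero_neq_one)
  qed
  have norm_v: "norm (v i) = 1" if "i \<in> I" for i
    using orth that by (simp add: norm_eq_1)
  \<comment> \<open>Adding the unit normal to the \<open>v i\<close> gives \<open>n - k + 1\<close>
    orthonormal vectors, hence a basis of the whole space. Expanding \<open>m\<close> in it shows
    that the tangential part of \<open>m\<close> is \<open>m - g *\<^sub>R N m\<close>.\<close>
  define B where "B = insert (N m) (v ` I)"
  have pB: "pairwise orthogonal B"
    using orth N_orth
    by (auto simp: B_def pairwise_insert pairwise_image orthogonal_def pairwise_def inner_commute)
  have nB: "norm b = 1" if "b \<in> B" for b
    using that norm_N norm_v by (auto simp: B_def)
  have ind_B: "independent B"
    using pairwise_orthogonal_independent[OF pB] nB by force
  have NB: "N m \<notin> v ` I"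
    using N_orth norm_N by (metis imageE norm_eq_1 zero_neq_one)
  have finB: "finite B" and card_B: "card B = DIM('b)"
    using NB I assms(4) by (simp_all add: B_def card_image[OF inj_v])
  have "span B = UNIV"
    using card_ge_dim_independent[OF subset_UNIV ind_B] card_B by auto
  then have "m = (\<Sum>b\<in>B. (m \<bullet> b) *\<^sub>R b)"
    using orthonormal_basis_expand[OF pB nB _ finB, of m] by simp
  also have "\<dots> = g *\<^sub>R N m + (\<Sum>i\<in>I. a i *\<^sub>R v i)"
    using NB I by (simp add: B_def sum.reindex[OF inj_v] fgh(2) a_def inner_commute)
  finally have m_eq: "(\<Sum>i\<in>I. a i *\<^sub>R v i) = m - g *\<^sub>R N m"
    by (simp add: algebra_simps)
  \<comment> \<open>This is Pythagoras: the sum is \<open>(norm m)\<^sup>2 - g\<^sup>2\<close>, and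
    the two squares are \<open>1 - f\<^sup>2\<close> and \<open>1 - h\<^sup>2\<close>.\<close>
  have "(\<Sum>i\<in>I. (a i)\<^sup>2) = (\<Sum>i\<in>I. a i *\<^sub>R v i) \<bullet> m"
    by (simp add: inner_sum_left a_def power2_eq_square)
  also have "\<dots> = h\<^sup>2 - f\<^sup>2"
    using f h by (simp add: m_eq inner_diff_left fgh(2)[symmetric] power2_norm_eq_inner)
      (simp add: power2_eq_square)
  finally have sum_a: "(\<Sum>i\<in>I. (a i)\<^sup>2) = h\<^sup>2 - f\<^sup>2" .

  have dim_T: "dim T = card I"
  proof -
    have "independent (v ` I)"
      using ind_B independent_mono by (auto simp: B_def)
    then show ?thesis
      using dim_span_eq_card_independent span_v by (metis card_image inj_v)
  qed
  have DN: "(N has_derivative N') (at m within M\<^sub>0)"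
    using smooth_map_on_has_derivative assms(7) m unfolding N'_def gauss_map_def by blast

  \<comment> \<open>Mean curvature of \<open>M\<^sub>0\<close>\<close>
  have "H\<^sub>0 = (\<Sum>i\<in>I. \<kappa> i) / real (card I)"
  proof -
    have "mean_curvature M\<^sub>0 (\<lambda>x. x) N m
        = (\<Sum>i\<in>I. if i = i then \<kappa> i else 0) / real (card I)"
    proof (rule mean_curvature_eq[where a = "\<lambda>i j. if i = j then \<kappa> i else 0",
          OF has_derivative_ident DN])
      show "- N' (v i) = (\<Sum>j\<in>I. (if i = j then \<kappa> i else 0) *\<^sub>R v j)" if "i \<in> I" for i
        using that dN I by (simp add: if_distrib[of "\<lambda>c. c *\<^sub>R _"] cong: if_cong)
    qed (use I dim_T span_v in \<open>simp_all add: T_def\<close>)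
    then show ?thesis using assms(17) by simp
  qed
  then have H0: "real (n - k) * H\<^sub>0 = (\<Sum>i\<in>I. \<kappa> i)"
    using I n by simp

  \<comment> \<open>Differentials of \<open>phi\<close> and \<open>xi\<close> at
    \<open>(y, m)\<close>\<close>
  define dg where "dg = (\<lambda>w. N' w \<bullet> m + N m \<bullet> w)"
  define D\<phi> where "D\<phi> = (\<lambda>(u, w). (- ((w \<bullet> m) / f) *\<^sub>R y + f *\<^sub>R u, w))"
  define D\<xi> where "D\<xi> = (\<lambda>(u, w).
     (((g * (w \<bullet> m) / f - f * dg w) / h - g\<^sup>2 * f * dg w / h ^ 3) *\<^sub>R y - (g * f / h) *\<^sub>R u,
      (g * dg w / h ^ 3) *\<^sub>R (N m - g *\<^sub>R m) + (1 / h) *\<^sub>R (N' w - dg w *\<^sub>R m - g *\<^sub>R w)))"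
  have D\<phi>: "(phi has_derivative D\<phi>) (at (y, m) within X)"
    using has_derivative_phi[of "(y, m)" X] norm_m by (simp add: D\<phi>_def fgh(1))
  \<comment> \<open>The point \<open>y\<close> witnesses that the sphere is nonempty, so the
    projection loses nothing of \<open>M\<^sub>0\<close>.\<close>
  have "snd ` X = M\<^sub>0" using y by (force simp: X_def)
  then have D\<xi>: "(xi N has_derivative D\<xi>) (at (y, m) within X)"
    using has_derivative_xi[of N N' "(y, m)" X] DN norm_m g1
    by (simp add: D\<xi>_def dg_def fgh)
  have TX: "tangent_space X (y, m) = {u. y \<bullet> u = 0} \<times> T"
    using tangent_space_sphere_Times[OF y] by (simp add: X_def T_def)
  have inj_D\<phi>: "inj D\<phi>"
    \<comment> \<open>In the kernel the second component gives \<open>w = 0\<close>; then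
      \<open>f *\<^sub>R u = 0\<close> with \<open>f > 0\<close>.\<close>
    using f has_derivative_linear[OF D\<phi>] by (auto simp: linear_injective_0 D\<phi>_def zero_prod_def)
  have D\<phi>_v: "D\<phi> (0, v i) = (- (a i / f) *\<^sub>R y, v i)" for i
    by (simp add: D\<phi>_def a_def)
  have first: "differential X phi (y, m) (0, v i) = (- ((v i \<bullet> m) / f) *\<^sub>R y, v i)"
    if "i \<in> I" for i
    using differential_eq[OF D\<phi>, of "(0, v i)"] vT[OF that] by (simp add: TX D\<phi>_v a_def)

  \<comment> \<open>Matrix of the shape operator\<close>
  obtain U where U: "U \<subseteq> {u. y \<bullet> u = 0}" "independent U" "{u. y \<bullet> u = 0} \<subseteq> span U"
    "card U = dim {u. y \<bullet> u = 0}"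
    by (rule basis_exists)
  have "y \<noteq> 0" using y by auto
  have "finite U" using U(2) by (rule independent_imp_finite)
  have card_U: "card U = k"
    using U(4) dim_hyperplane[OF \<open>y \<noteq> 0\<close>] assms(3) by simp
  \<comment> \<open>Left indices are the vectors of a basis of the orthogonal complement of
    \<open>y\<close>, right indices number the \<open>v i\<close>.\<close>
  define e where "e = case_sum (\<lambda>u. (u, 0)) (\<lambda>i. (0 :: 'a, v i))"
  \<comment> \<open>The coefficients can be read off from second components:
    \<open>D\<phi> (0, v j)\<close> has \<open>v j\<close> there, and
    \<open>m - g *\<^sub>R N m\<close> expands with coefficients \<open>a j\<close>.\<close>
  define c where "c = (\<lambda>i j. (if i = j then (g + \<kappa> i) / h else 0) - \<kappa> i * a i * a j / h ^ 3)"
  define A :: "'a + nat \<Rightarrow> 'a + nat \<Rightarrow> real" where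
    "A = case_sum (\<lambda>u. case_sum (\<lambda>u'. if u = u' then g / h else 0) (\<lambda>_. 0))
                  (\<lambda>i. case_sum (\<lambda>_. 0) (c i))"

  \<comment> \<open>This is the image of the tangential part of \<open>m\<close>, the vector onto
    which the rank-one term of \<open>c\<close> maps.\<close>
  have sum_D\<phi>: "(\<Sum>j\<in>I. a j *\<^sub>R D\<phi> (0, v j)) = (- ((h\<^sup>2 - f\<^sup>2) / f) *\<^sub>R y, m - g *\<^sub>R N m)"
  proof -
    have "(\<Sum>j\<in>I. a j *\<^sub>R D\<phi> (0, v j))
        = (- ((\<Sum>j\<in>I. (a j)\<^sup>2) / f) *\<^sub>R y, \<Sum>j\<in>I. a j *\<^sub>R v j)"
      unfolding D\<phi>_v
      by (simp add: prod_eq_iff fst_sum snd_sum sum_negf sum_divide_distrib scaleR_sum_left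
          power2_eq_square)
    then show ?thesis by (simp add: sum_a m_eq)
  qed
  have D\<xi>_v: "- D\<xi> (0, v i) = (\<Sum>j\<in>I. c i j *\<^sub>R D\<phi> (0, v j))" if i: "i \<in> I" for i
  proof -
    have "(\<Sum>j\<in>I. c i j *\<^sub>R D\<phi> (0, v j))
        = (\<Sum>j\<in>I. (if i = j then (g + \<kappa> i) / h else 0) *\<^sub>R D\<phi> (0, v j))
          - (\<kappa> i * a i / h ^ 3) *\<^sub>R (\<Sum>j\<in>I. a j *\<^sub>R D\<phi> (0, v j))"
      by (simp add: c_def scaleR_diff_left sum_subtractf scaleR_sum_right)
    also have "(\<Sum>j\<in>I. (if i = j then (g + \<kappa> i) / h else 0) *\<^sub>R D\<phi> (0, v j))
        = ((g + \<kappa> i) / h) *\<^sub>R D\<phi> (0, v i)"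
      using i I by (simp add: if_distrib[of "\<lambda>c. c *\<^sub>R _"] cong: if_cong)
    also have "\<dots> - (\<kappa> i * a i / h ^ 3) *\<^sub>R (\<Sum>j\<in>I. a j *\<^sub>R D\<phi> (0, v j))
        = (- ((g + \<kappa> i) / h * (a i / f) - \<kappa> i * a i / h ^ 3 * ((h\<^sup>2 - f\<^sup>2) / f)) *\<^sub>R y,
           ((g + \<kappa> i) / h) *\<^sub>R v i - (\<kappa> i * a i / h ^ 3) *\<^sub>R (m - g *\<^sub>R N m))"
      unfolding sum_D\<phi> unfolding D\<phi>_v by (simp add: algebra_simps)
    finally have rhs: "(\<Sum>j\<in>I. c i j *\<^sub>R D\<phi> (0, v j)) = \<dots>" .
    \<comment> \<open>The term \<open>N m \<bullet> v i\<close> vanishes, which leaves only the one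
      from \<open>N'\<close>.\<close>
    have dg: "dg (v i) = - \<kappa> i * a i"
      using dN N_orth i by (simp add: dg_def a_def)
    have g2: "g\<^sup>2 = 1 - h\<^sup>2" using h by simp
    \<comment> \<open>First components: once \<open>g\<^sup>2\<close> is eliminated, both sides are
      \<open>g * a i / (f * h) + f * \<kappa> i * a i / h ^ 3\<close>.\<close>
    have 1: "(g * a i / f + f * (\<kappa> i * a i)) / h + g\<^sup>2 * f * (\<kappa> i * a i) / h ^ 3
        = (g + \<kappa> i) / h * (a i / f) - \<kappa> i * a i / h ^ 3 * ((h\<^sup>2 - f\<^sup>2) / f)"
      unfolding g2 using f(1) h(1) by (simp add: field_simps power2_eq_square power3_eq_cube)
    \<comment> \<open>This is the coefficient of \<open>m\<close> in the second component; it
      collapses because \<open>g\<^sup>2 + h\<^sup>2 = 1\<close>.\<close>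
    have "g * g * \<kappa> i * a i / h ^ 3 + \<kappa> i * a i / h = (g\<^sup>2 + h\<^sup>2) * (\<kappa> i * a i) / h ^ 3"
      using h(1) by (simp add: field_simps power2_eq_square power3_eq_cube)
    then have 2: "g * g * \<kappa> i * a i / h ^ 3 + \<kappa> i * a i / h = \<kappa> i * a i / h ^ 3"
      by (simp add: g2)
    have "- snd (D\<xi> (0, v i)) = ((g + \<kappa> i) / h) *\<^sub>R v i + (\<kappa> i * a i / h ^ 3 * g) *\<^sub>R N m
        - (g * g * \<kappa> i * a i / h ^ 3 + \<kappa> i * a i / h) *\<^sub>R m"
      using dN i by (simp add: D\<xi>_def dg algebra_simps add_divide_distrib)
    then have snd: "- snd (D\<xi> (0, v i))
        = ((g + \<kappa> i) / h) *\<^sub>R v i - (\<kappa> i * a i / h ^ 3) *\<^sub>R (m - g *\<^sub>R N m)"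
      unfolding 2 by (simp add: algebra_simps)
    have "- fst (D\<xi> (0, v i))
        = - ((g * a i / f + f * (\<kappa> i * a i)) / h + g\<^sup>2 * f * (\<kappa> i * a i) / h ^ 3) *\<^sub>R y"
      by (simp add: D\<xi>_def dg a_def algebra_simps)
    with snd show ?thesis
      unfolding rhs 1 by (simp add: prod_eq_iff)
  qed

  \<comment> \<open>Trace over the product frame\<close>
  have "mean_curvature X phi (xi N) (y, m)
      = (\<Sum>s\<in>U <+> I. A s s) / real (card (U <+> I))"
  proof (rule mean_curvature_eq[where a = A and e = e, OF D\<phi> D\<xi> inj_D\<phi>])
    show "finite (U <+> I)" using \<open>finite U\<close> I by simp
    show "dim (tangent_space X (y, m)) = card (U <+> I)"
      using TX U(4) dim_T \<open>finite U\<close> I sub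
      by (simp add: dim_Times subspace_hyperplane card_Plus)
    show "span (e ` (U <+> I)) = tangent_space X (y, m)"
    proof (rule subset_antisym)
      show "span (e ` (U <+> I)) \<subseteq> tangent_space X (y, m)"
        unfolding TX using U(1) vT subspace_0[OF sub] sub
        by (intro span_minimal subspace_Times subspace_hyperplane) (auto simp: e_def)
      \<comment> \<open>The pair splits as \<open>(u, 0) + (0, w)\<close>, and each linear embedding
        commutes with \<open>span\<close>.\<close>
      have "(u, w) \<in> span (e ` (U <+> I))" if "y \<bullet> u = 0" "w \<in> T" for u w
      proof -
        let ?l = "\<lambda>u::'a. (u, 0 :: 'b)" and ?r = "\<lambda>w::'b. (0 :: 'a, w)"
        have "?l u \<in> ?l ` span U" "?r w \<in> ?r ` span (v ` I)"
          using U(3) that span_v by auto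
        moreover have "span (?l ` U) = ?l ` span U"
          by (rule linear_span_image) (auto intro!: linearI)
        moreover have "span (?r ` v ` I) = ?r ` span (v ` I)"
          by (rule linear_span_image) (auto intro!: linearI)
        ultimately have "?l u \<in> span (?l ` U)" "?r w \<in> span (?r ` v ` I)"
          by (simp_all only:)
        moreover have "?l ` U \<subseteq> e ` (U <+> I)" "?r ` v ` I \<subseteq> e ` (U <+> I)"
          by (force simp: e_def)+
        ultimately have "?l u + ?r w \<in> span (e ` (U <+> I))"
          by (meson span_add span_mono subsetD)
        then show ?thesis by simp
      qed
      then show "tangent_space X (y, m) \<subseteq> span (e ` (U <+> I))"
        unfolding TX by auto
    qed
    show "- D\<xi> (e s) = (\<Sum>t\<in>U <+> I. A s t *\<^sub>R D\<phi> (e t))" if "s \<in> U <+> I" for s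
    proof (cases s)
      case (Inl u)
      \<comment> \<open>With \<open>w = 0\<close> all terms in \<open>dg\<close> and
        \<open>N'\<close> vanish, leaving \<open>(f *\<^sub>R u, 0)\<close> for
        \<open>D\<phi>\<close> and \<open>- (g / h)\<close> times it for
        \<open>D\<xi>\<close>.\<close>
      have "N' 0 = 0" using DN has_derivative_linear linear_0 by blast
      then have "- D\<xi> (e s) = (g / h) *\<^sub>R D\<phi> (e s)"
        by (simp add: Inl D\<xi>_def D\<phi>_def e_def dg_def)
      moreover have "u \<in> U" using that Inl by auto
      ultimately show ?thesis
        using \<open>finite U\<close> I Inl
        by (simp add: sum.Plus A_def if_distrib[of "\<lambda>c. c *\<^sub>R _"] cong: if_cong)
    next
      case (Inr i)
      then have "i \<in> I" using that by auto
      then show ?thesis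
        using D\<xi>_v \<open>finite U\<close> I Inr by (simp add: sum.Plus A_def e_def)
    qed
  qed
  moreover have "(\<Sum>s\<in>U <+> I. A s s) = (\<Sum>u\<in>U. g / h) + (\<Sum>i\<in>I. c i i)"
    using \<open>finite U\<close> I by (simp add: sum.Plus A_def)
  moreover have "card (U <+> I) = n"
    using \<open>finite U\<close> I card_U n by (simp add: card_Plus)
  ultimately have "real n * H = real k * (g / h) + (\<Sum>i\<in>I. c i i)"
    using assms(16) card_U n by (simp add: X_def)
  also have "(\<Sum>i\<in>I. c i i)
      = (real (n - k) * g + real (n - k) * H\<^sub>0) / h - 1 / h ^ 3 * (\<Sum>i\<in>I. \<kappa> i * (a i)\<^sup>2)"
    using I by (simp add: H0 c_def sum_subtractf sum.distrib sum_distrib_left sum_divide_distrib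
        add_divide_distrib power2_eq_square mult.assoc)
  \<comment> \<open>The sphere contributes \<open>k\<close> copies of \<open>g / h\<close> and the
    \<open>v i\<close> contribute \<open>n - k\<close>; as \<open>k < n\<close>, the natural
    subtraction is exact and they add up to \<open>n\<close>.\<close>
  also have "real k * (g / h) + \<dots>
      = (real n * g + real (n - k) * H\<^sub>0) / h - 1 / h ^ 3 * (\<Sum>i\<in>I. \<kappa> i * (a i)\<^sup>2)"
    using n by (simp add: of_nat_diff algebra_simps add_divide_distrib diff_divide_distrib)
  finally show ?thesis
    using first by (simp add: X_def I_def a_def)
qed

end
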